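(* Let $k$ be an integer. Then the generalized Bernoulli numbers $B_n^{(m)}$ and the Bernoulli numbers $B_n$ satisfy, for all integers $n\ge 0$, $$B_{n+1}^{(k)}=\sum_{i=0}^{n}\left(k\binom{n}{i}-\binom{n}{i+1}\right)B_{i+1}B_{n-i}^{(k)}$$ and $$B_{n+1}^{(-k)}=\sum_{i=0}^{n}\left(k\binom{n}{i}-\binom{n}{i+1}\right)\frac{1}{i+2}B_{n-i}^{(-k)}.$$
   Context: For any integer $m$, the generalized Bernoulli numbers $B_n^{(m)}$ are defined by the formal power series identity $\left(1+\sum_{n\geq 1}\frac{1}{(n+1)!}X^{n}\right)^{-m}=1+\sum_{n\geq 1}\frac{1}{n!}B_{n}^{(m)}X^{n}$, with $B_0^{(m)}=1$; the Bernoulli numbers are $B_n=B_n^{(1)}$. Here $\binom{n}{n+1}=0$. *)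

theory Defs
  imports "HOL-Computational_Algebra.Formal_Power_Series"
begin

definition bernoulli_base_fps :: "rat fps" where
  "bernoulli_base_fps = Abs_fps (\<lambda>n. 1 / fact (n + 1))"

definition gen_bernoulli :: "int \<Rightarrow> nat \<Rightarrow> rat" where
  "gen_bernoulli m n = fact n * fps_nth (bernoulli_base_fps powi (- m)) n"

text \<open>This is the convention with \<open>bernoulli 1 = - 1 / 2\<close>.\<close>
definition bernoulli :: "nat \<Rightarrow> rat" where
  "bernoulli n = gen_bernoulli 1 n"

text \<open>The base series has constant term \<open>1\<close>, so it is a unit among the power series;
  the power with a negative exponent is therefore the power of a true inverse.\<close>
lemma bernoulli_base_fps_inverse: "bernoulli_base_fps * inverse bernoulli_base_fps = 1"
  by (rule inverse_mult_eq_1') (simp add: bernoulli_base_fps_def)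

lemma bernoulli_base_fps_powi:
  "bernoulli_base_fps powi (- m) = Abs_fps (\<lambda>n. gen_bernoulli m n / fact n)"
  by (rule fps_ext) (simp add: gen_bernoulli_def)

lemma gen_bernoulli_0: "gen_bernoulli m 0 = 1"
  by (simp add: gen_bernoulli_def power_int_def bernoulli_base_fps_def fps_power_zeroth)

end

theory Submission
  imports Defs
begin

text \<open>
  Both identities are one identity for integer powers of a power series.  A power
  \<open>A = g powi k\<close> of a unit \<open>g\<close> has logarithmic derivative \<open>k\<close> times that of \<open>g\<close>, so that
  \<open>g * A' = k * g' * A\<close> (lemma \<open>fps_deriv_powi_mult\<close>).  Write \<open>b\<close> and \<open>a\<close> for the exponential
  coefficients of \<open>g\<close> and \<open>A\<close>.  Comparing coefficients gives
  \<open>\<Sum>i. (n choose i) * b i * a (n + 1 - i) = k * (\<Sum>i. (n choose i) * b (i + 1) * a (n - i))\<close>.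
  If \<open>b 0 = 1\<close>, the term \<open>i = 0\<close> on the left is \<open>a (n + 1)\<close>; shifting the index in the
  remaining terms turns \<open>n choose i\<close> into \<open>n choose (i + 1)\<close>, and solving for \<open>a (n + 1)\<close>
  yields the recursion \<open>fps_powi_egf_recursion\<close>.

  Let \<open>E = (exp X - 1) / X\<close> be the base series.  The exponential coefficients of \<open>E powi (- k)\<close>
  are the generalized Bernoulli numbers of order \<open>k\<close>.  Taking \<open>g = inverse E\<close>, whose
  exponential coefficients are the Bernoulli numbers, gives the first identity; taking \<open>g = E\<close>, whose
  exponential coefficients are \<open>1 / (i + 1)\<close>, gives the second.
\<close>

text \<open>The library laws for \<open>powi\<close> assume a division ring, which power series are not; for a unit
  the inversion rule holds because inversion is an involution there.\<close>
lemma fps_inverse_powi: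
  fixes g :: "'a::field fps"
  assumes "fps_nth g 0 \<noteq> 0"
  shows "inverse g powi k = g powi (- k)"
  using assms by (auto simp: power_int_def)

text \<open>For negative exponents this rests on \<open>g * h' = - g' * h\<close> for \<open>h = inverse g\<close>, which is
  the derivative of \<open>g * h = 1\<close>.\<close>
lemma fps_deriv_powi_mult:
  fixes g :: "'a::field fps"
  assumes "fps_nth g 0 \<noteq> 0"
  shows "g * fps_deriv (g powi k) = of_int k * fps_deriv g * g powi k"
proof (cases "k \<ge> 0")
  case True
  have "g * fps_deriv (g ^ m) = of_nat m * fps_deriv g * g ^ m" for m
    by (induction m) (simp_all add: algebra_simps)
  from this[of "nat k"] True show ?thesis
    by (simp add: power_int_def)
next
  case False
  define h where "h = inverse g"
  have "g * h = 1"
    using assms by (simp add: h_def inverse_mult_eq_1')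
  then have "fps_deriv (g * h) = 0"
    by simp
  then have dh: "g * fps_deriv h = - (fps_deriv g * h)"
    by (simp add: algebra_simps eq_neg_iff_add_eq_0)
  have "g * fps_deriv (h ^ m) = - (of_nat m * fps_deriv g * h ^ m)" for m
  proof (induction m)
    case (Suc m)
    have "g * fps_deriv (h ^ Suc m) = (g * fps_deriv h) * h ^ m + h * (g * fps_deriv (h ^ m))"
      by (simp add: algebra_simps)
    also have "\<dots> = - (of_nat (Suc m) * fps_deriv g * h ^ Suc m)"
      unfolding dh Suc.IH by (simp add: algebra_simps)
    finally show ?case .
  qed simp
  from this[of "nat (- k)"] False show ?thesis
    by (simp add: power_int_def h_def)
qed

lemma fps_mult_nth_egf:
  fixes f g :: "'a::field_char_0 fps"
  shows "fact n * fps_nth (f * g) n =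
    (\<Sum>i=0..n. of_nat (n choose i) * (fact i * fps_nth f i) * (fact (n - i) * fps_nth g (n - i)))"
  unfolding fps_mult_nth sum_distrib_left
  by (intro sum.cong refl) (simp add: binomial_fact field_simps)

lemma fact_mult_fps_deriv_nth:
  fixes f :: "'a::field_char_0 fps"
  shows "fact n * fps_nth (fps_deriv f) n = fact (n + 1) * fps_nth f (n + 1)"
  by (simp add: algebra_simps)

lemma fps_powi_egf_recursion:
  fixes g :: "'a::field_char_0 fps" and k :: int
  defines "a \<equiv> \<lambda>n. fact n * fps_nth (g powi k) n"
    and "b \<equiv> \<lambda>n. fact n * fps_nth g n"
  assumes g0: "fps_nth g 0 = 1"
  shows "a (n + 1) =
    (\<Sum>i=0..n. (of_int k * of_nat (n choose i) - of_nat (n choose (i + 1))) * b (i + 1) * a (n - i))"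
proof -
  have "fact n * fps_nth (g * fps_deriv (g powi k)) n =
        of_int k * (fact n * fps_nth (fps_deriv g * g powi k) n)"
    using g0 by (simp add: fps_deriv_powi_mult mult.assoc fps_of_int[symmetric])
  then have conv: "(\<Sum>i=0..n. of_nat (n choose i) * b i * a (n - i + 1)) =
      of_int k * (\<Sum>i=0..n. of_nat (n choose i) * b (i + 1) * a (n - i))"
    unfolding fps_mult_nth_egf fact_mult_fps_deriv_nth a_def b_def .
  \<comment> \<open>The summand at \<open>i = n + 1\<close> vanishes with its binomial coefficient, so the sum may be extended
    and its first term split off.\<close>
  have "(\<Sum>i=0..n. of_nat (n choose i) * b i * a (n - i + 1)) =
        (\<Sum>i=0..Suc n. of_nat (n choose i) * b i * a (n + 1 - i))"
    by (simp add: Suc_diff_le)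
  also have "\<dots> = a (n + 1) + (\<Sum>i=0..n. of_nat (n choose (i + 1)) * b (i + 1) * a (n - i))"
    using g0 by (subst sum.atLeast0_atMost_Suc_shift) (simp add: b_def)
  finally have "a (n + 1) = of_int k * (\<Sum>i=0..n. of_nat (n choose i) * b (i + 1) * a (n - i))
      - (\<Sum>i=0..n. of_nat (n choose (i + 1)) * b (i + 1) * a (n - i))"
    unfolding conv by (simp add: algebra_simps)
  also have "\<dots> = (\<Sum>i=0..n. (of_int k * of_nat (n choose i) - of_nat (n choose (i + 1)))
      * b (i + 1) * a (n - i))"
    by (simp add: sum_distrib_left sum_subtractf algebra_simps)
  finally show ?thesis .
qed

theorem theorem2p12:
  fixes k :: int and n :: nat
  shows "gen_bernoulli k (n + 1) =
           (\<Sum>i=0..n. (of_int k * of_nat (n choose i) - of_nat (n choose (i + 1)))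
                        * bernoulli (i + 1) * gen_bernoulli k (n - i))
         \<and> gen_bernoulli (- k) (n + 1) =
           (\<Sum>i=0..n. (of_int k * of_nat (n choose i) - of_nat (n choose (i + 1)))
                        * (1 / of_nat (i + 2)) * gen_bernoulli (- k) (n - i))"
proof
  let ?E = bernoulli_base_fps
  have E0: "fps_nth ?E 0 = 1"
    by (simp add: bernoulli_base_fps_def)
  have gen: "gen_bernoulli k j = fact j * fps_nth (inverse ?E powi k) j" for j
    using E0 by (simp add: gen_bernoulli_def fps_inverse_powi)
  have bern: "bernoulli j = fact j * fps_nth (inverse ?E) j" for j
    by (simp add: bernoulli_def gen_bernoulli_def power_int_def)
  show "gen_bernoulli k (n + 1) =
           (\<Sum>i=0..n. (of_int k * of_nat (n choose i) - of_nat (n choose (i + 1)))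
                        * bernoulli (i + 1) * gen_bernoulli k (n - i))"
    unfolding gen bern by (rule fps_powi_egf_recursion) (simp add: E0)
  have gen_neg: "gen_bernoulli (- k) j = fact j * fps_nth (?E powi k) j" for j
    by (simp add: gen_bernoulli_def)
  have recip: "1 / of_nat (i + 2) = fact (i + 1) * fps_nth ?E (i + 1)" for i
    by (simp add: bernoulli_base_fps_def field_simps del: of_nat_Suc)
  show "gen_bernoulli (- k) (n + 1) =
           (\<Sum>i=0..n. (of_int k * of_nat (n choose i) - of_nat (n choose (i + 1)))
                        * (1 / of_nat (i + 2)) * gen_bernoulli (- k) (n - i))"
    unfolding gen_neg recip by (rule fps_powi_egf_recursion) (rule E0)
qed

end
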